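(* Let $LFK$ denote the set of long flat virtual knot diagrams and $LVK$ the set of long virtual knot diagrams, and let $A: LFK \longrightarrow LVK$ be the map sending a long flat virtual knot diagram $S$ to its ascending long virtual knot diagram $A(S)$. Then $A$ is well-defined on the corresponding isotopy classes of diagrams (if $S$ and $T$ are isotopic long flat virtual knot diagrams then $A(S)$ and $A(T)$ are isotopic long virtual knot diagrams), and the induced map on isotopy classes is injective. Hence long flat virtual knots embed in the class of long virtual knots.
   Context: A long virtual knot diagram is a one-component $1$-$1$ tangle diagram in the plane (a generic immersed arc with one input end on the left and one output end on the right) each of whose double points is either a classical crossing (with over/under information) or a virtual crossing (neither over nor under, indicated by a small circle). Two long virtual knot diagrams are isotopic if they are related by a finite sequence of planar isotopies, classical Reidemeister moves I, II, III (on classical crossings), and detour moves: a segment of the diagram containing only a sequence of consecutive virtual crossings may be excised and replaced by any other generic segment with the same endpoints, all of whose crossings with the rest of the diagram (and with itself) are virtual. The ends at infinity are kept fixed. (The "forbidden moves", which pass an over-strand or an under-strand across a virtual crossing, are not allowed.) A long flat virtual knot diagram is the same kind of diagram in which each double point is either a virtual crossing or a flat crossing (an undecorated double point without over/under information). Two long flat virtual knot diagrams are isotopic if they are related by a finite sequence of planar isotopies, flat Reidemeister moves (Reidemeister moves I, II, III among flat crossings, ignoring over/under information), and detour moves (a segment of the diagram containing only a sequence of consecutive virtual crossings may be excised and replaced by any other generic segment with the same endpoints, all of whose crossings with the rest of the diagram and with itself are virtual), with the ends at infinity kept fixed. The analogues of the forbidden moves, in which flat crossings are detoured across virtual crossings,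 are not allowed. Ascending map: given a long flat virtual knot diagram $S$, traverse $S$ from its left end to its right end and turn each flat crossing into a classical crossing in such a way that one passes under each crossing before passing over that crossing. Virtual crossings are not changed. The result is $A(S)$. *)

theory Defs
  imports "HOL-Analysis.Analysis"
begin

section \<open>Diagrams\<close>

text \<open>
  A long curve is parametrised by the whole real line and runs along the real axis of the plane
  near both ends: it comes in from the left and goes out to the right.  Generic immersions, planar
  isotopies and local pictures are all taken in the \<open>C\<^sup>1\<close> category.
\<close>

definition generic_long_curve :: "(real \<Rightarrow> complex) \<Rightarrow> bool" where
  "generic_long_curve \<gamma> \<longleftrightarrow>
     \<gamma> C1_differentiable_on UNIV \<and>
     (\<forall>t. vector_derivative \<gamma> (at t) \<noteq> 0) \<and>
     (\<exists>R. \<forall>t. \<bar>t\<bar> \<ge> R \<longrightarrow> \<gamma> t = of_real t) \<and>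
     finite {(s, t). s \<noteq> t \<and> \<gamma> s = \<gamma> t} \<and>
     (\<forall>s t. s \<noteq> t \<and> \<gamma> s = \<gamma> t \<longrightarrow>
        \<not> collinear {0, vector_derivative \<gamma> (at s), vector_derivative \<gamma> (at t)}) \<and>
     (\<forall>s t u. \<gamma> s = \<gamma> t \<and> \<gamma> t = \<gamma> u \<longrightarrow> s = t \<or> t = u \<or> s = u)"

definition double_points :: "(real \<Rightarrow> complex) \<Rightarrow> complex set" where
  "double_points \<gamma> = {p. \<exists>s t. s \<noteq> t \<and> \<gamma> s = p \<and> \<gamma> t = p}"

text \<open>
  The double points outside \<open>virt\<close> are the flat crossings, respectively the classical crossings.
  A classical crossing is passed at two parameters; \<open>over\<close> contains the one of the over-passage.
\<close>

record long_flat_diagram =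
  curve :: "real \<Rightarrow> complex"
  virt :: "complex set"

record long_diagram = long_flat_diagram +
  over :: "real set"

definition LFK :: "long_flat_diagram set" where
  "LFK = {S. generic_long_curve (curve S) \<and> virt S \<subseteq> double_points (curve S)}"

definition LVK :: "long_diagram set" where
  "LVK = {D. generic_long_curve (curve D) \<and> virt D \<subseteq> double_points (curve D) \<and>
     over D \<subseteq> {t. curve D t \<in> double_points (curve D) - virt D} \<and>
     (\<forall>s t. s \<noteq> t \<and> curve D s = curve D t \<and> curve D s \<notin> virt D \<longrightarrow>
        (s \<in> over D \<longleftrightarrow> t \<notin> over D))}"

definition ascending :: "long_flat_diagram \<Rightarrow> long_diagram" where
  "ascending S = \<lparr>curve = curve S, virt = virt S,
     over = {t. curve S t \<notin> virt S \<and> (\<exists>s<t. curve S s = curve S t)}\<rparr>"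


section \<open>Planar isotopy\<close>

definition C1_map :: "('a::real_normed_vector \<Rightarrow> 'b::real_normed_vector) \<Rightarrow> bool" where
  "C1_map f \<longleftrightarrow> (\<exists>f' :: 'a \<Rightarrow> 'a \<Rightarrow>\<^sub>L 'b.
     (\<forall>x. (f has_derivative blinfun_apply (f' x)) (at x)) \<and> continuous_on UNIV f')"

definition C1_diffeo :: "('a::real_normed_vector \<Rightarrow> 'a) \<Rightarrow> bool" where
  "C1_diffeo f \<longleftrightarrow> bij f \<and> C1_map f \<and> C1_map (inv f)"

definition ambient_isotopy :: "(real \<Rightarrow> complex \<Rightarrow> complex) \<Rightarrow> bool" where
  "ambient_isotopy H \<longleftrightarrow>
     continuous_on ({0..1} \<times> UNIV) (\<lambda>(s, z). H s z) \<and>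
     (\<forall>s\<in>{0..1}. C1_diffeo (H s)) \<and>
     H 0 = id \<and>
     (\<exists>R. \<forall>s\<in>{0..1}. \<forall>z. norm z \<ge> R \<longrightarrow> H s z = z)"

text \<open>
  The reparametrisation \<open>\<phi>\<close> expresses that only the oriented image of the curve matters.
\<close>

definition planar_isotopy ::
  "(complex \<Rightarrow> complex) \<Rightarrow> (real \<Rightarrow> real) \<Rightarrow> 'a long_flat_diagram_scheme
     \<Rightarrow> 'a long_flat_diagram_scheme \<Rightarrow> bool" where
  "planar_isotopy h \<phi> S T \<longleftrightarrow>
     (\<exists>H. ambient_isotopy H \<and> H 1 = h) \<and>
     C1_diffeo \<phi> \<and> strict_mono \<phi> \<and>
     curve T = h \<circ> curve S \<circ> \<phi> \<and> virt T = h ` virt S"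


section \<open>Detour moves\<close>

definition virtual_segment :: "real \<Rightarrow> real \<Rightarrow> 'a long_flat_diagram_scheme \<Rightarrow> bool" where
  "virtual_segment a b S \<longleftrightarrow>
     (\<forall>t\<in>{a..b}. curve S t \<in> double_points (curve S) \<longrightarrow> curve S t \<in> virt S)"

definition detour ::
  "real \<Rightarrow> real \<Rightarrow> 'a long_flat_diagram_scheme \<Rightarrow> 'a long_flat_diagram_scheme \<Rightarrow> bool" where
  "detour a b S T \<longleftrightarrow>
     a < b \<and> virtual_segment a b S \<and> virtual_segment a b T \<and>
     (\<forall>t. t \<notin> {a<..<b} \<longrightarrow> curve T t = curve S t) \<and>
     virt T - curve T ` {a..b} = virt S - curve S ` {a..b}"


section \<open>Reidemeister moves\<close>

text \<open>
  The two sides of each Reidemeister move are drawn in the square \<open>[-1, 1] \<times> [-1, 1]\<close>, as lists of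
  strands parametrised by \<open>[-1, 1]\<close>.  The function \<open>(1 - u\<^sup>2)\<^sup>2\<close> vanishes together with its
  derivative at both ends, so the two sides fit together up to first order at the boundary.
  In move I the strand \<open>RI_loop\<close> meets itself at \<open>u\<close> and \<open>-u\<close> with \<open>(1 - u\<^sup>2)\<^sup>2 = 1/4\<close>.
  In move II the second strand is pushed across the first, creating crossings where
  \<open>(1 - u\<^sup>2)\<^sup>2 = 1/2\<close>.  In move III the third strand is pushed from above to below the crossing
  (at the origin) of the first two.
\<close>

definition hump :: "real \<Rightarrow> real" where
  "hump u = (1 - u\<^sup>2)\<^sup>2"

definition RI_loop :: "real \<Rightarrow> complex" where
  "RI_loop u = Complex (u * (1 - 4 * hump u)) (hump u / 2)"

definition reidemeister_pictures ::
  "((real \<Rightarrow> complex) list \<times> (real \<Rightarrow> complex) list) set" where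
  "reidemeister_pictures =
     {([\<lambda>u. Complex u 0],
       [RI_loop]),
      ([\<lambda>u. Complex u 0, \<lambda>u. Complex u (1/2)],
       [\<lambda>u. Complex u 0, \<lambda>u. Complex u (1/2 - hump u)]),
      ([\<lambda>u. Complex u (u/2), \<lambda>u. Complex u (- u/2), \<lambda>u. Complex u (hump u / 4)],
       [\<lambda>u. Complex u (u/2), \<lambda>u. Complex u (- u/2), \<lambda>u. Complex u (- hump u / 4)])}"

definition square :: "complex set" where
  "square = {z. \<bar>Re z\<bar> \<le> 1 \<and> \<bar>Im z\<bar> \<le> 1}"

text \<open>
  Strand \<open>i\<close> of a local picture is traversed by the diagram at the parameters \<open>c i + d i * u\<close>, where
  \<open>u\<close> is in \<open>[-1, 1]\<close>; it is traversed backwards if \<open>d i\<close> is negative.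
\<close>

definition strand_interval :: "(nat \<Rightarrow> real) \<Rightarrow> (nat \<Rightarrow> real) \<Rightarrow> nat \<Rightarrow> real set" where
  "strand_interval c d i = (\<lambda>u. c i + d i * u) ` {-1..1}"

text \<open>
  The diagram meets the disc \<open>\<psi> ` square\<close> exactly in the image of the picture \<open>ms\<close>, and all
  crossings in this disc are flat, respectively classical.
\<close>

definition shows_picture ::
  "(complex \<Rightarrow> complex) \<Rightarrow> (nat \<Rightarrow> real) \<Rightarrow> (nat \<Rightarrow> real) \<Rightarrow> (real \<Rightarrow> complex) list
     \<Rightarrow> 'a long_flat_diagram_scheme \<Rightarrow> bool" where
  "shows_picture \<psi> c d ms S \<longleftrightarrow>
     (\<forall>i<length ms. \<forall>u\<in>{-1..1}. curve S (c i + d i * u) = \<psi> ((ms ! i) u)) \<and>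
     curve S -` (\<psi> ` square) = (\<Union>i<length ms. strand_interval c d i) \<and>
     virt S \<inter> \<psi> ` square = {}"

definition local_replacement ::
  "(complex \<Rightarrow> complex) \<Rightarrow> (nat \<Rightarrow> real) \<Rightarrow> (nat \<Rightarrow> real)
     \<Rightarrow> (real \<Rightarrow> complex) list \<Rightarrow> (real \<Rightarrow> complex) list
     \<Rightarrow> 'a long_flat_diagram_scheme \<Rightarrow> 'a long_flat_diagram_scheme \<Rightarrow> bool" where
  "local_replacement \<psi> c d ms ms' S T \<longleftrightarrow>
     C1_diffeo \<psi> \<and>
     (\<forall>i<length ms. d i \<noteq> 0) \<and>
     disjoint_family_on (strand_interval c d) {..<length ms} \<and>
     shows_picture \<psi> c d ms S \<and> shows_picture \<psi> c d ms' T \<and>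
     (\<forall>t. t \<notin> (\<Union>i<length ms. strand_interval c d i) \<longrightarrow> curve T t = curve S t) \<and>
     virt T = virt S"

text \<open>
  For classical diagrams the over/under information has to be that of strands lying at different
  heights: this is no condition for move I, it says for move II that the same strand is over at
  both crossings, and for move III that there are a top, a middle and a bottom strand.
\<close>

definition strands_at_heights ::
  "(nat \<Rightarrow> nat) \<Rightarrow> (nat \<Rightarrow> real) \<Rightarrow> (nat \<Rightarrow> real) \<Rightarrow> nat \<Rightarrow> long_diagram \<Rightarrow> bool" where
  "strands_at_heights h c d n D \<longleftrightarrow>
     (\<forall>i<n. \<forall>j<n. \<forall>s\<in>strand_interval c d i. \<forall>t\<in>strand_interval c d j.
        h i < h j \<and> curve D s = curve D t \<longrightarrow> s \<notin> over D \<and> t \<in> over D)"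


section \<open>Isotopy of diagrams\<close>

definition flat_move :: "long_flat_diagram \<Rightarrow> long_flat_diagram \<Rightarrow> bool" where
  "flat_move S T \<longleftrightarrow>
     (\<exists>h \<phi>. planar_isotopy h \<phi> S T) \<or>
     (\<exists>a b. detour a b S T) \<or>
     (\<exists>(ms, ms') \<in> reidemeister_pictures. \<exists>\<psi> c d. local_replacement \<psi> c d ms ms' S T)"

definition virtual_move :: "long_diagram \<Rightarrow> long_diagram \<Rightarrow> bool" where
  "virtual_move D E \<longleftrightarrow>
     (\<exists>h \<phi>. planar_isotopy h \<phi> D E \<and> over E = \<phi> -` over D) \<or>
     (\<exists>a b. detour a b D E \<and> over E = over D) \<or>
     (\<exists>(ms, ms') \<in> reidemeister_pictures. \<exists>\<psi> c d.
        local_replacement \<psi> c d ms ms' D E \<and>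
        over E - (\<Union>i<length ms. strand_interval c d i) =
        over D - (\<Union>i<length ms. strand_interval c d i) \<and>
        (\<exists>h. inj_on h {..<length ms} \<and>
           strands_at_heights h c d (length ms) D \<and> strands_at_heights h c d (length ms) E))"

definition generated_equiv :: "'a set \<Rightarrow> ('a \<Rightarrow> 'a \<Rightarrow> bool) \<Rightarrow> ('a \<times> 'a) set" where
  "generated_equiv X m =
     (let r = {(x, y) \<in> X \<times> X. m x y \<or> m y x} in r\<^sup>* \<inter> X \<times> X)"

lemma equiv_generated_equiv: "equiv X (generated_equiv X m)"
proof -
  have "sym {(x, y) \<in> X \<times> X. m x y \<or> m y x}"
    by (auto intro: symI)
  then have "sym ({(x, y) \<in> X \<times> X. m x y \<or> m y x}\<^sup>*)"
    by (rule sym_rtrancl)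
  then show ?thesis
    unfolding equiv_def generated_equiv_def Let_def
    by (auto simp: refl_on_def sym_def trans_def intro: rtrancl_trans)
qed

definition flat_isotopy :: "(long_flat_diagram \<times> long_flat_diagram) set" where
  "flat_isotopy = generated_equiv LFK flat_move"

definition virtual_isotopy :: "(long_diagram \<times> long_diagram) set" where
  "virtual_isotopy = generated_equiv LVK virtual_move"

definition ascending_class :: "long_flat_diagram set \<Rightarrow> long_diagram set" where
  "ascending_class K = (\<Union>S\<in>K. virtual_isotopy `` {ascending S})"

end

theory Submission
  imports Defs
begin

text \<open>
  Why the ascending map is an embedding.  It has a left inverse: forgetting which strand passes over
  turns \<open>ascending S\<close> back into \<open>S\<close>.  Since every move of classical diagrams becomes a flat move once
  the crossing information is forgotten (\<open>flat_move_flatten\<close>), an isotopy from \<open>ascending S\<close> to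
  \<open>ascending T\<close> projects to a flat isotopy from \<open>S\<close> to \<open>T\<close>.  This is injectivity.

  For well-definedness, every flat move from \<open>S\<close> to \<open>T\<close> lifts to a move of the same kind from
  \<open>ascending S\<close> to \<open>ascending T\<close> (\<open>virtual_move_ascending\<close>).  In an ascending diagram, the
  over-passage of a crossing is the later of its two passages, a rule that refers only to the order
  of parameters.  Reparametrisations are increasing and detours leave the flat crossings alone, so
  the rule survives both.  In a Reidemeister move the strands occupy disjoint parameter intervals,
  which are linearly ordered; the ascending rule puts each strand above all the earlier ones.  So
  the order of traversal provides the heights that the classical move asks for, whichever of
  the three moves it is.
\<close>

section \<open>Forgetting the crossing information\<close>

definition flatten :: "long_diagram \<Rightarrow> long_flat_diagram" where
  "flatten D = \<lparr>curve = curve D, virt = virt D\<rparr>"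

lemma curve_flatten [simp]: "curve (flatten D) = curve D"
  and virt_flatten [simp]: "virt (flatten D) = virt D"
  by (simp_all add: flatten_def)

lemma curve_ascending [simp]: "curve (ascending S) = curve S"
  and virt_ascending [simp]: "virt (ascending S) = virt S"
  by (simp_all add: ascending_def)

lemma over_ascending:
  "t \<in> over (ascending S) \<longleftrightarrow> curve S t \<notin> virt S \<and> (\<exists>s<t. curve S s = curve S t)"
  by (simp add: ascending_def)

lemma flatten_ascending [simp]: "flatten (ascending S) = S"
  by (simp add: flatten_def)

lemma flatten_in_LFK: "D \<in> LVK \<Longrightarrow> flatten D \<in> LFK"
  by (simp add: LFK_def LVK_def)

text \<open>
  All three kinds of moves are defined by conditions on \<open>curve\<close> and \<open>virt\<close> alone, to which the
  classical moves only add conditions on \<open>over\<close>.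
\<close>

lemma planar_isotopy_cong:
  fixes S T :: "'a long_flat_diagram_scheme" and S' T' :: "'b long_flat_diagram_scheme"
  assumes "curve S' = curve S" "virt S' = virt S" "curve T' = curve T" "virt T' = virt T"
  shows "planar_isotopy h \<phi> S' T' \<longleftrightarrow> planar_isotopy h \<phi> S T"
  by (simp add: planar_isotopy_def assms)

lemma detour_cong:
  fixes S T :: "'a long_flat_diagram_scheme" and S' T' :: "'b long_flat_diagram_scheme"
  assumes "curve S' = curve S" "virt S' = virt S" "curve T' = curve T" "virt T' = virt T"
  shows "detour a b S' T' \<longleftrightarrow> detour a b S T"
  by (simp add: detour_def virtual_segment_def assms)

lemma local_replacement_cong:
  fixes S T :: "'a long_flat_diagram_scheme" and S' T' :: "'b long_flat_diagram_scheme"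
  assumes "curve S' = curve S" "virt S' = virt S" "curve T' = curve T" "virt T' = virt T"
  shows "local_replacement \<psi> c d ms ms' S' T' \<longleftrightarrow> local_replacement \<psi> c d ms ms' S T"
  by (simp add: local_replacement_def shows_picture_def assms)

lemma flat_move_flatten:
  assumes "virtual_move D E"
  shows "flat_move (flatten D) (flatten E)"
proof -
  have "planar_isotopy h \<phi> (flatten D) (flatten E) \<longleftrightarrow> planar_isotopy h \<phi> D E" for h \<phi>
    by (rule planar_isotopy_cong) simp_all
  moreover have "detour a b (flatten D) (flatten E) \<longleftrightarrow> detour a b D E" for a b
    by (rule detour_cong) simp_all
  moreover have "local_replacement \<psi> c d ms ms' (flatten D) (flatten E) \<longleftrightarrow>
      local_replacement \<psi> c d ms ms' D E" for \<psi> c d ms ms'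
    by (rule local_replacement_cong) simp_all
  ultimately show ?thesis
    using assms unfolding flat_move_def virtual_move_def by fast
qed


section \<open>Lifting flat moves to ascending diagrams\<close>

lemma no_triple_point:
  assumes "S \<in> LFK" "curve S s = curve S t" "curve S t = curve S u"
  shows "s = t \<or> t = u \<or> s = u"
  using assms by (simp add: LFK_def generic_long_curve_def)

lemma double_pointI: "s < t \<Longrightarrow> \<gamma> s = \<gamma> t \<Longrightarrow> \<gamma> t \<in> double_points \<gamma>"
  unfolding double_points_def mem_Collect_eq by (intro exI [of _ s] exI [of _ t]) simp

lemma ascending_in_LVK:
  assumes S: "S \<in> LFK"
  shows "ascending S \<in> LVK"
proof -
  have "s \<in> over (ascending S) \<longleftrightarrow> t \<notin> over (ascending S)"
    if "s \<noteq> t" "curve S s = curve S t" "curve S s \<notin> virt S" for s t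
  proof -
    \<comment> \<open>Without triple points, an earlier passage through the crossing can only be the other one.\<close>
    have "r = t" if "r < s" "curve S r = curve S s" for r
      using no_triple_point [OF S that(2) \<open>curve S s = curve S t\<close>] that(1) \<open>s \<noteq> t\<close> by blast
    moreover have "r = s" if "r < t" "curve S r = curve S t" for r
      using no_triple_point [OF S that(2) \<open>curve S s = curve S t\<close> [symmetric]] that(1) \<open>s \<noteq> t\<close>
      by blast
    ultimately have "s \<in> over (ascending S) \<longleftrightarrow> t < s" "t \<in> over (ascending S) \<longleftrightarrow> s < t"
      using that(2,3) unfolding over_ascending by metis+
    then show ?thesis
      using that by auto
  qed
  moreover have "over (ascending S) \<subseteq> {t. curve S t \<in> double_points (curve S) - virt S}"
    by (auto simp only: over_ascending mem_Collect_eq intro: double_pointI)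
  ultimately show ?thesis
    using S unfolding LVK_def LFK_def mem_Collect_eq curve_ascending virt_ascending by blast
qed

lemma over_ascending_planar_isotopy:
  assumes "planar_isotopy h \<phi> S T"
  shows "over (ascending T) = \<phi> -` over (ascending S)"
proof -
  obtain H where "ambient_isotopy H" "H 1 = h"
    using assms by (auto simp: planar_isotopy_def)
  then have h: "inj h"
    by (auto simp: ambient_isotopy_def C1_diffeo_def bij_def)
  have \<phi>: "strict_mono \<phi>" "surj \<phi>"
    and T: "curve T = h \<circ> curve S \<circ> \<phi>" "virt T = h ` virt S"
    using assms by (auto simp: planar_isotopy_def C1_diffeo_def bij_def)
  have "(\<exists>s<t. P (\<phi> s)) \<longleftrightarrow> (\<exists>s<\<phi> t. P s)" for P t
  proof
    assume "\<exists>s<t. P (\<phi> s)"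
    then show "\<exists>s<\<phi> t. P s"
      using strict_monoD [OF \<phi>(1)] by blast
  next
    assume "\<exists>s<\<phi> t. P s"
    then obtain s where "s < \<phi> t" "P s"
      by blast
    moreover obtain r where "s = \<phi> r"
      using \<phi>(2) by (auto elim: surjE)
    ultimately show "\<exists>s<t. P (\<phi> s)"
      using \<phi>(1) by (auto simp: strict_mono_less)
  qed
  from this [of _ "\<lambda>s. curve S s = curve S (\<phi> _)"] show ?thesis
    using h by (simp add: set_eq_iff over_ascending T inj_image_mem_iff inj_eq)
qed

lemma detour_sym: "detour a b S T \<Longrightarrow> detour a b T S"
  by (auto simp: detour_def)

lemma over_ascending_detour_subset:
  assumes T: "T \<in> LFK" and det: "detour a b S T"
  shows "over (ascending S) \<subseteq> over (ascending T)"
proof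
  fix t
  assume "t \<in> over (ascending S)"
  then obtain s where s: "s < t" "curve S s = curve S t" and nv: "curve S t \<notin> virt S"
    by (auto simp: over_ascending)
  then have "curve S t \<in> double_points (curve S)"
    by (auto simp only: intro: double_pointI)
  \<comment> \<open>The crossing is not virtual, so the detoured segment avoids both of its passages.\<close>
  with s nv det have out: "s \<notin> {a..b}" "t \<notin> {a..b}"
    unfolding detour_def virtual_segment_def by (metis, metis)
  with det have eq: "curve T s = curve S s" "curve T t = curve S t"
    by (auto simp: detour_def)
  \<comment> \<open>The new segment avoids the crossing, where it would create a triple point.\<close>
  have "curve T t \<notin> curve T ` {a..b}"
  proof
    assume "curve T t \<in> curve T ` {a..b}"
    then obtain u where "u \<in> {a..b}" "curve T t = curve T u"
      by blast
    moreover have "curve T s = curve T t"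
      using s eq by simp
    ultimately show False
      using no_triple_point [OF T, of s t u] s(1) out by auto
  qed
  then have "curve T t \<notin> virt T"
    using det nv eq by (auto simp: detour_def)
  then show "t \<in> over (ascending T)"
    using s eq by (auto simp: over_ascending)
qed

lemma over_ascending_detour:
  assumes "S \<in> LFK" "T \<in> LFK" "detour a b S T"
  shows "over (ascending T) = over (ascending S)"
  using assms over_ascending_detour_subset detour_sym by blast

lemma over_ascending_local_replacement_subset:
  fixes c d ms
  defines "J \<equiv> \<Union>i<length ms. strand_interval c d i"
  assumes "local_replacement \<psi> c d ms ms' S T"
  shows "over (ascending S) - J \<subseteq> over (ascending T) - J"
proof
  fix t
  assume t: "t \<in> over (ascending S) - J"
  then obtain s where s: "s < t" "curve S s = curve S t" and nv: "curve S t \<notin> virt S"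
    by (auto simp: over_ascending)
  have J: "curve S -` (\<psi> ` square) = J" and eq: "\<And>t. t \<notin> J \<Longrightarrow> curve T t = curve S t"
    and v: "virt T = virt S"
    using assms by (auto simp: local_replacement_def shows_picture_def)
  \<comment> \<open>Passages of one point are both inside or both outside the disc of the move.\<close>
  have "s \<notin> J"
    using t s(2) unfolding J [symmetric] by simp
  then show "t \<in> over (ascending T) - J"
    using t s nv eq v by (auto simp: over_ascending)
qed

lemma local_replacement_sym:
  assumes "length ms' = length ms" "local_replacement \<psi> c d ms ms' S T"
  shows "local_replacement \<psi> c d ms' ms T S"
  using assms by (auto simp: local_replacement_def)

text \<open>The passages of a crossing by two strands come in the order of the strands' midpoints.\<close>

lemma strand_interval_less:
  assumes "disjoint_family_on (strand_interval c d) I" "i \<in> I" "j \<in> I" "c i < c j"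
    and s: "s \<in> strand_interval c d i" and t: "t \<in> strand_interval c d j"
  shows "s < t"
proof (rule ccontr)
  assume "\<not> s < t"
  have ivl: "strand_interval c d k = {c k - \<bar>d k\<bar>..c k + \<bar>d k\<bar>}" for k
  proof -
    have "strand_interval c d k = (+) (c k) ` ((*) (d k) ` {-1..1})"
      by (simp add: strand_interval_def image_image)
    also have "\<dots> = {c k - \<bar>d k\<bar>..c k + \<bar>d k\<bar>}"
      by (auto simp: image_mult_atLeastAtMost_if abs_if)
    finally show ?thesis .
  qed
  \<comment> \<open>Otherwise one interval contains the smaller of \<open>s\<close> and \<open>c j\<close>, and so does the other.\<close>
  have "min s (c j) \<in> strand_interval c d i" "min s (c j) \<in> strand_interval c d j"
    using s t \<open>c i < c j\<close> \<open>\<not> s < t\<close> unfolding ivl by auto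
  moreover have "strand_interval c d i \<inter> strand_interval c d j = {}"
    using assms(1-3) \<open>c i < c j\<close> unfolding disjoint_family_on_def by (metis less_irrefl)
  ultimately show False
    by blast
qed

text \<open>
  Heights of strands are natural numbers, so the real midpoints are replaced by their ranks.
\<close>

definition traversal_rank :: "nat \<Rightarrow> (nat \<Rightarrow> real) \<Rightarrow> nat \<Rightarrow> nat" where
  "traversal_rank n c i = card {k\<in>{..<n}. c k < c i}"

lemma traversal_rank_mono:
  "c i \<le> c j \<Longrightarrow> traversal_rank n c i \<le> traversal_rank n c j"
  unfolding traversal_rank_def by (intro card_mono) auto

lemma traversal_rank_strict_mono:
  assumes "c i < c j" "i < n"
  shows "traversal_rank n c i < traversal_rank n c j"
  unfolding traversal_rank_def using assms by (intro psubset_card_mono) auto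

lemma inj_on_traversal_rank:
  assumes "disjoint_family_on (strand_interval c d) {..<n}"
  shows "inj_on (traversal_rank n c) {..<n}"
proof (rule inj_onI)
  fix i j
  assume ij: "i \<in> {..<n}" "j \<in> {..<n}" and "traversal_rank n c i = traversal_rank n c j"
  then have "c i = c j"
    using traversal_rank_strict_mono [of c i j n] traversal_rank_strict_mono [of c j i n]
    by (cases "c i" "c j" rule: linorder_cases) auto
  moreover have "c k \<in> strand_interval c d k" for k
    by (auto simp: strand_interval_def intro!: image_eqI [of _ _ 0])
  ultimately show "i = j"
    using assms ij unfolding disjoint_family_on_def by (metis IntI empty_iff)
qed

lemma strands_at_heights_ascending:
  assumes S: "S \<in> LFK" and disj: "disjoint_family_on (strand_interval c d) {..<length ms}"
    and pic: "shows_picture \<psi> c d ms S"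
  shows "strands_at_heights (traversal_rank (length ms) c) c d (length ms) (ascending S)"
  unfolding strands_at_heights_def
proof (intro allI impI ballI, elim conjE)
  fix i j s t
  assume ij: "i < length ms" "j < length ms"
    and s: "s \<in> strand_interval c d i" and t: "t \<in> strand_interval c d j"
    and "traversal_rank (length ms) c i < traversal_rank (length ms) c j"
    and "curve (ascending S) s = curve (ascending S) t"
  then have eq: "curve S s = curve S t" and "c i < c j"
    using traversal_rank_mono [of c j i "length ms"] by (auto simp: not_le [symmetric])
  with s t ij have "s < t"
    using strand_interval_less [OF disj, of i j] by auto
  have "t \<in> curve S -` (\<psi> ` square)"
    using pic t ij by (auto simp: shows_picture_def)
  then have "curve S t \<notin> virt S"
    using pic by (auto simp: shows_picture_def)
  moreover have "\<not> (\<exists>r<s. curve S r = curve S s)"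
    using no_triple_point [OF S, of _ s t] \<open>s < t\<close> eq by fastforce
  ultimately show "s \<notin> over (ascending S) \<and> t \<in> over (ascending S)"
    using \<open>s < t\<close> eq by (auto simp: over_ascending)
qed

lemma virtual_move_ascending:
  assumes S: "S \<in> LFK" and T: "T \<in> LFK" and "flat_move S T"
  shows "virtual_move (ascending S) (ascending T)"
proof -
  consider (planar) h \<phi> where "planar_isotopy h \<phi> S T"
    | (detour) a b where "detour a b S T"
    | (reidemeister) ms ms' \<psi> c d where
      "(ms, ms') \<in> reidemeister_pictures" "local_replacement \<psi> c d ms ms' S T"
    using \<open>flat_move S T\<close> unfolding flat_move_def by fast
  then show ?thesis
  proof cases
    case planar
    then have "planar_isotopy h \<phi> (ascending S) (ascending T)"
      by (subst planar_isotopy_cong [of _ S _ T]) simp_all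
    with over_ascending_planar_isotopy [OF planar] show ?thesis
      unfolding virtual_move_def by blast
  next
    case detour
    then have "detour a b (ascending S) (ascending T)"
      by (subst detour_cong [of _ S _ T]) simp_all
    with over_ascending_detour [OF S T detour] show ?thesis
      unfolding virtual_move_def by blast
  next
    case reidemeister
    let ?J = "\<Union>i<length ms. strand_interval c d i"
    let ?h = "traversal_rank (length ms) c"
    have len: "length ms' = length ms"
      using reidemeister(1) by (auto simp: reidemeister_pictures_def)
    have disj: "disjoint_family_on (strand_interval c d) {..<length ms}"
      and pic: "shows_picture \<psi> c d ms S" "shows_picture \<psi> c d ms' T"
      using reidemeister(2) by (auto simp: local_replacement_def)
    have repl: "local_replacement \<psi> c d ms ms' (ascending S) (ascending T)"
      using reidemeister(2) by (subst local_replacement_cong [of _ S _ T]) simp_all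
    have "over (ascending T) - ?J \<subseteq> over (ascending S) - ?J"
      using over_ascending_local_replacement_subset
        [OF local_replacement_sym [OF len reidemeister(2)]] len by simp
    with over_ascending_local_replacement_subset [OF reidemeister(2)]
    have outside: "over (ascending T) - ?J = over (ascending S) - ?J"
      by (rule equalityI [rotated])
    have heights: "inj_on ?h {..<length ms}"
      "strands_at_heights ?h c d (length ms) (ascending S)"
      "strands_at_heights ?h c d (length ms) (ascending T)"
      using inj_on_traversal_rank [OF disj] strands_at_heights_ascending [OF S disj pic(1)]
        strands_at_heights_ascending [of T c d ms' \<psi>] T disj pic(2) len by auto
    show ?thesis
      unfolding virtual_move_def
      by (intro disjI2 bexI [OF _ reidemeister(1)] case_prodI exI [of _ \<psi>] exI [of _ c]
          exI [of _ d] exI [of _ ?h] conjI repl outside heights)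
  qed
qed


section \<open>Passage to isotopy classes\<close>

lemma generated_equiv_map:
  assumes "(x, y) \<in> generated_equiv X m"
    and f: "\<And>x. x \<in> X \<Longrightarrow> f x \<in> Y"
    and move: "\<And>x y. x \<in> X \<Longrightarrow> y \<in> X \<Longrightarrow> m x y \<Longrightarrow> m' (f x) (f y)"
  shows "(f x, f y) \<in> generated_equiv Y m'"
proof -
  let ?r = "{(x, y) \<in> X \<times> X. m x y \<or> m y x}"
  let ?r' = "{(x, y) \<in> Y \<times> Y. m' x y \<or> m' y x}"
  have xy: "(x, y) \<in> ?r\<^sup>*" "x \<in> X" "y \<in> X"
    using assms(1) by (auto simp: generated_equiv_def Let_def)
  have "(f x, f y) \<in> ?r'\<^sup>*"
    using xy(1)
  proof induction
    case base
    show ?case by simp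
  next
    case (step y z)
    then have "(f y, f z) \<in> ?r'"
      using f move by auto
    with step.IH show ?case
      by (rule rtrancl_into_rtrancl)
  qed
  with xy f show ?thesis
    by (simp add: generated_equiv_def Let_def)
qed

lemma ascending_isotopic:
  "(S, T) \<in> flat_isotopy \<Longrightarrow> (ascending S, ascending T) \<in> virtual_isotopy"
  unfolding flat_isotopy_def virtual_isotopy_def
  by (erule generated_equiv_map) (auto intro: ascending_in_LVK virtual_move_ascending)

lemma flatten_isotopic:
  "(D, E) \<in> virtual_isotopy \<Longrightarrow> (flatten D, flatten E) \<in> flat_isotopy"
  unfolding flat_isotopy_def virtual_isotopy_def
  by (erule generated_equiv_map) (auto intro: flatten_in_LFK flat_move_flatten)

lemma equiv_flat_isotopy: "equiv LFK flat_isotopy"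
  and equiv_virtual_isotopy: "equiv LVK virtual_isotopy"
  unfolding flat_isotopy_def virtual_isotopy_def by (rule equiv_generated_equiv)+

lemma ascending_class_eq:
  assumes S: "S \<in> LFK"
  shows "ascending_class (flat_isotopy `` {S}) = virtual_isotopy `` {ascending S}"
proof -
  have "virtual_isotopy `` {ascending T} = virtual_isotopy `` {ascending S}"
    if "(S, T) \<in> flat_isotopy" for T
    using equiv_class_eq [OF equiv_virtual_isotopy ascending_isotopic [OF that]] by simp
  moreover have "S \<in> flat_isotopy `` {S}"
    using equiv_class_self [OF equiv_flat_isotopy S] .
  ultimately show ?thesis
    unfolding ascending_class_def by blast
qed

lemma inj_on_ascending_class: "inj_on ascending_class (LFK // flat_isotopy)"
proof (rule inj_onI, elim quotientE)
  fix K L S T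
  assume eq: "ascending_class K = ascending_class L"
    and S: "S \<in> LFK" "K = flat_isotopy `` {S}" and T: "T \<in> LFK" "L = flat_isotopy `` {T}"
  then have "virtual_isotopy `` {ascending S} = virtual_isotopy `` {ascending T}"
    by (simp add: ascending_class_eq)
  then have "(ascending S, ascending T) \<in> virtual_isotopy"
    using equiv_virtual_isotopy ascending_in_LVK T(1) by (metis eq_equiv_class)
  then have "(S, T) \<in> flat_isotopy"
    using flatten_isotopic by fastforce
  then show "K = L"
    using S T equiv_class_eq [OF equiv_flat_isotopy] by simp
qed

theorem mainTheorem1:
  shows "(\<forall>S\<in>LFK. ascending S \<in> LVK) \<and>
    (\<forall>S T. (S, T) \<in> flat_isotopy \<longrightarrow> (ascending S, ascending T) \<in> virtual_isotopy) \<and>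
    (\<forall>S\<in>LFK. ascending_class (flat_isotopy `` {S}) = virtual_isotopy `` {ascending S}) \<and>
    inj_on ascending_class (LFK // flat_isotopy)"
  using ascending_in_LVK ascending_isotopic ascending_class_eq inj_on_ascending_class by blast

end
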